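(* If $R_4(3) = 51$, then $R_n(3) \le n!(e - 5/8) + 1$ for all integers $n \ge 4$.
   Context: For an integer $n \ge 1$, the $n$-color Ramsey number $R_n(3) = R(3,\dots,3)$ denotes the smallest positive integer $N$ such that, for any coloring of the edges of the complete graph $K_N$ with $n$ colors, there is a monochromatic triangle. Here $e$ denotes the base of the natural logarithm. *)

theory Defs
  imports Complex_Main "HOL-Library.Ramsey"
begin

text \<open>The \<open>n\<close>-colour Ramsey number \<open>R\<^sub>n(3)\<close>. The edges of the complete graph on the vertex
  set \<open>{..<N}\<close> are the elements of \<open>nsets {..<N} 2\<close>, the colours are \<open>{..<n}\<close>, and \<open>partn\<close> says
  that every colouring of these edges has a monochromatic 3-element vertex set.\<close>

definition ramsey_triangle :: "nat \<Rightarrow> nat" where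
  "ramsey_triangle n = (LEAST N. N > 0 \<and> partn {..<N} 3 2 {..<n})"

text \<open>The minimum is taken over a nonempty set.\<close>

lemma ramsey_triangle_exists: "\<exists>N>0. partn {..<N::nat} 3 2 {..<n::nat}"
proof -
  obtain N :: nat where "partn_lst {..<N} (replicate n 3) 2"
    using ramsey_full by blast
  then have "partn_lst {..<Suc N} (replicate n 3) 2"
    by (rule partn_lst_greater_resource) simp
  then have "partn {..<Suc N} 3 2 {..<n}"
    unfolding partn_lst_def partn_def by fastforce
  then show ?thesis
    by blast
qed

end

theory Submission
  imports Defs
begin

text \<open>Put \<open>r\<^sub>n = R\<^sub>n(3) - 1\<close>. Among the other vertices seen from a fixed one, some colour
  occurs on many edges, and the corresponding neighbourhood either contains an edge of that colour
  or is coloured with one colour less; hence \<open>r\<^sub>n\<^sub>+\<^sub>1 \<le> (n + 1) r\<^sub>n + 1\<close>. Dividing by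
  \<open>(n + 1)!\<close>, this says that \<open>r\<^sub>n / n! - (1/0! + \<dots> + 1/n!)\<close> is nonincreasing in \<open>n\<close>. At \<open>n = 4\<close>
  it equals \<open>50/24 - 65/24 = -5/8\<close>, and the partial sums are bounded by \<open>e\<close>.\<close>

text \<open>A colouring of \<open>B\<close> is pulled back along \<open>g\<close> and its colours
  are renamed by \<open>h\<close>; a monochromatic set found in \<open>A\<close> is then pushed
  forward by \<open>g\<close>. This carries a Ramsey property of initial segments over to an
  arbitrary neighbourhood and an arbitrary set of remaining colours.\<close>

lemma partn_transfer:
  assumes p: "partn A \<alpha> \<gamma> C"
    and g: "inj_on g A" "g ` A \<subseteq> B"
    and h: "bij_betw h D C"
  shows "partn B \<alpha> \<gamma> D"
  unfolding partn_def
proof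
  fix f assume f: "f \<in> nsets B \<gamma> \<rightarrow> D"
  have fg: "f \<circ> (`) g \<in> nsets A \<gamma> \<rightarrow> D"
    by (rule nsets_compose_image_funcset[OF f _ g(1)]) (use g(2) in blast)
  have "h \<in> D \<rightarrow> C"
    using h by (rule bij_betw_imp_funcset)
  with fg have "h \<circ> (f \<circ> (`) g) \<in> nsets A \<gamma> \<rightarrow> C"
    by (simp add: Pi_iff)
  with p have "\<exists>c\<in>C. monochromatic A \<alpha> \<gamma> (h \<circ> (f \<circ> (`) g)) c"
    unfolding partn_def by (rule bspec)
  then obtain c H where c: "c \<in> C" and H: "H \<in> nsets A \<alpha>"
    and mono: "(h \<circ> (f \<circ> (`) g)) ` nsets H \<gamma> \<subseteq> {c}"
    unfolding monochromatic_def by (elim bexE)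
  from c h obtain d where d: "d \<in> D" "h d = c"
    by (auto simp: bij_betw_def)
  have HA: "H \<subseteq> A" using H by (simp add: nsets_def)
  then have injH: "inj_on g H" using g(1) inj_on_subset by blast
  have gHB: "g ` H \<subseteq> B"
    using image_mono[OF HA] g(2) by (rule subset_trans)
  then have "g ` H \<in> nsets B \<alpha>"
    using H injH by (auto simp: nsets_def card_image)
  moreover have "f X = d" if X: "X \<in> nsets (g ` H) \<gamma>" for X
  proof -
    obtain Y where Y: "Y \<in> nsets H \<gamma>" "X = g ` Y"
      using nset_image_obtains[OF X injH] .
    have "X \<in> nsets B \<gamma>"
      using X nsets_mono[OF gHB] by (rule rev_subsetD)
    then have "f X \<in> D" using f by blast
    \<comment> \<open>Only the renamed colours are known to agree; injectivity of \<open>h\<close>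
      on \<open>D\<close> gives back \<open>f X = d\<close>.\<close>
    moreover have "h (f X) = h d"
      using mono Y d by auto
    ultimately show ?thesis
      using h d by (auto simp: bij_betw_def inj_on_def)
  qed
  ultimately have "monochromatic B \<alpha> \<gamma> f d"
    unfolding monochromatic_def by (intro bexI[of _ "g ` H"] image_subsetI) simp_all
  with d(1) show "\<exists>\<xi>\<in>D. monochromatic B \<alpha> \<gamma> f \<xi>" ..
qed

text \<open>Vertex 0 has \<open>Suc n * m + 1\<close> neighbours, one more than \<open>Suc n\<close>
  colour classes of size \<open>m\<close> can hold, so some class has the \<open>Suc m\<close>
  vertices that \<open>p\<close> asks for.\<close>

lemma partn_triangle_Suc:
  assumes p: "partn {..<Suc m} 3 2 {..<n}"
  shows "partn {..<Suc (Suc (Suc n * m))} 3 2 {..<Suc n}"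
  unfolding partn_def
proof
  let ?V = "{..<Suc (Suc (Suc n * m))}"
  define W where "W = {1..<Suc (Suc (Suc n * m))}"
  fix f assume f: "f \<in> nsets ?V 2 \<rightarrow> {..<Suc n}"
  define U where "U c = {w \<in> W. f {0, w} = c}" for c
  have "\<exists>c<Suc n. card (U c) > m"
  proof (rule ccontr)
    assume "\<not> ?thesis"
    then have le: "card (U c) \<le> m" if "c < Suc n" for c
      using that not_less by blast
    have "W = (\<Union>c<Suc n. U c)"
      using f by (auto simp: U_def W_def Pi_iff)
    then have "card W \<le> (\<Sum>c<Suc n. card (U c))"
      by (metis card_UN_le finite_lessThan)
    also have "\<dots> \<le> (\<Sum>c<Suc n. m)"
      using le by (intro sum_mono) auto
    \<comment> \<open>The chain reads \<open>Suc n * m + 1 \<le> Suc n * m\<close>.\<close>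
    finally show False by (simp add: W_def)
  qed
  then obtain c where c: "c < Suc n" and cU: "m < card (U c)" by blast
  have UW: "U c \<subseteq> W" by (auto simp: U_def)
  then have UV: "U c \<subseteq> ?V" by (auto simp: W_def)
  have finU: "finite (U c)" using UW by (rule finite_subset) (simp add: W_def)
  show "\<exists>\<xi>\<in>{..<Suc n}. monochromatic ?V 3 2 f \<xi>"
  proof (cases "\<exists>e\<in>nsets (U c) 2. f e = c")
    case True
    \<comment> \<open>An edge of colour \<open>c\<close> inside \<open>U c\<close> closes a triangle
      with vertex 0.\<close>
    then obtain x y where xy: "x \<in> U c" "y \<in> U c" "x \<noteq> y" "f {x, y} = c"
      by (metis nsets2_E)
    then have pos: "x \<noteq> 0" "y \<noteq> 0" using UW by (auto simp: W_def)
    have "{0, x, y} \<in> nsets ?V 3"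
      using xy UV pos by (auto simp: nsets_def)
    moreover have "f ` nsets {0, x, y} 2 \<subseteq> {c}"
      using xy by (auto simp: nsets_2_eq U_def insert_commute)
    ultimately have "monochromatic ?V 3 2 f c"
      unfolding monochromatic_def by (rule bexI[rotated])
    with c show ?thesis by auto
  next
    case False
    \<comment> \<open>Colour \<open>c\<close> is absent inside \<open>U c\<close>, so
      \<open>n\<close> colours remain there and \<open>p\<close> applies after transfer.\<close>
    have "card {..<Suc m} \<le> card (U c)" using cU by simp
    then obtain g where g: "inj_on g {..<Suc m}" "g ` {..<Suc m} \<subseteq> U c"
      using card_le_inj[OF _ finU] by blast
    have "card ({..<Suc n} - {c}) = card {..<n}"
      using c by simp
    then obtain h where h: "bij_betw h ({..<Suc n} - {c}) {..<n}"
      by (metis finite_same_card_bij finite_Diff finite_lessThan)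
    have "partn (U c) 3 2 ({..<Suc n} - {c})"
      using partn_transfer[OF p g h] .
    moreover have "f \<in> nsets (U c) 2 \<rightarrow> {..<Suc n} - {c}"
      using f False nsets_mono[OF UV] by fast
    ultimately have "\<exists>d\<in>{..<Suc n} - {c}. monochromatic (U c) 3 2 f d"
      unfolding partn_def by (rule bspec)
    then obtain d where d: "d \<in> {..<Suc n} - {c}" and "monochromatic (U c) 3 2 f d" ..
    then have "monochromatic ?V 3 2 f d"
      using nsets_mono[OF UV, of 3] unfolding monochromatic_def by (meson subsetD)
    with d show ?thesis by auto
  qed
qed

lemma
  shows ramsey_triangle_pos: "ramsey_triangle n > 0"
    and partn_ramsey_triangle: "partn {..<ramsey_triangle n} 3 2 {..<n}"
proof -
  have "ramsey_triangle n > 0 \<and> partn {..<ramsey_triangle n} 3 2 {..<n}"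
    unfolding ramsey_triangle_def by (rule LeastI_ex) (rule ramsey_triangle_exists)
  then show "ramsey_triangle n > 0" "partn {..<ramsey_triangle n} 3 2 {..<n}"
    by blast+
qed

lemma ramsey_triangle_Suc_le:
  "ramsey_triangle (Suc n) \<le> Suc n * (ramsey_triangle n - 1) + 2"
proof -
  obtain m where m: "ramsey_triangle n = Suc m"
    using ramsey_triangle_pos gr0_implies_Suc by blast
  then have "partn {..<Suc (Suc (Suc n * m))} 3 2 {..<Suc n}"
    using partn_ramsey_triangle[of n] by (intro partn_triangle_Suc) simp
  then have "ramsey_triangle (Suc n) \<le> Suc (Suc (Suc n * m))"
    unfolding ramsey_triangle_def by (intro Least_le) simp
  with m show ?thesis by simp
qed

lemma sum_inverse_fact_le_exp_1: "(\<Sum>k\<le>n. 1 / fact k) \<le> (exp 1 :: real)"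
proof -
  have "(\<lambda>k. 1 / fact k) sums (exp 1 :: real)"
    using exp_converges[of "1::real"] by (simp add: inverse_eq_divide)
  then show ?thesis
    using sum_le_suminf[of "\<lambda>k. 1 / fact k :: real" "{..n}"]
    by (simp add: sums_iff)
qed

theorem corollary2p9:
  assumes "ramsey_triangle 4 = 51"
  shows "\<forall>n\<ge>4. real (ramsey_triangle n) \<le> fact n * (exp 1 - 5/8) + 1"
proof (intro allI impI)
  fix n :: nat
  assume "n \<ge> 4"
  \<comment> \<open>The bound with \<open>exp 1\<close> does not reproduce itself under the
    recursion, which adds 1 at each step; the partial sum grows just enough to absorb it.\<close>
  then have "real (ramsey_triangle n) \<le> fact n * ((\<Sum>k\<le>n. 1 / fact k) - 5/8) + 1"
  proof (induction n rule: dec_induct)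
    case base
    \<comment> \<open>Equality holds here: \<open>24 * (65/24 - 5/8) + 1 = 51\<close>.\<close>
    show ?case
      using assms by (simp add: atMost_nat_numeral fact_numeral)
  next
    case (step n)
    have "real (ramsey_triangle (Suc n)) \<le> real (Suc n * (ramsey_triangle n - 1) + 2)"
      using ramsey_triangle_Suc_le of_nat_le_iff by blast
    also have "\<dots> = real (Suc n) * (real (ramsey_triangle n) - 1) + 2"
      using ramsey_triangle_pos[of n] by (simp del: mult_Suc)
    also have "\<dots> \<le> real (Suc n) * (fact n * ((\<Sum>k\<le>n. 1 / fact k) - 5/8)) + 2"
      using step.IH by (intro add_right_mono mult_left_mono) simp_all
    also have "\<dots> = fact (Suc n) * ((\<Sum>k\<le>n. 1 / fact k) - 5/8) + 2"
      by (simp only: fact_Suc mult.assoc of_nat_fact)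
    \<comment> \<open>One unit of the 2 becomes \<open>fact (Suc n) * (1 / fact (Suc n))\<close>,
      the new last term.\<close>
    also have "\<dots> = fact (Suc n) * ((\<Sum>k\<le>Suc n. 1 / fact k) - 5/8) + 1"
      by (simp add: distrib_left right_diff_distrib del: fact_Suc)
    finally show ?case .
  qed
  also have "\<dots> \<le> fact n * (exp 1 - 5/8) + 1"
    using sum_inverse_fact_le_exp_1[of n] by simp
  finally show "real (ramsey_triangle n) \<le> fact n * (exp 1 - 5/8) + 1" .
qed

end
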